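(* For every group $G$, every $N$-series $H_\bullet$ of $G$ and every degree $n\ge 1$, there is an isomorphism of abelian groups $$\operatorname{coker}R_n^{\rm bar}\;\cong\;\ker\phi_n .$$
   Context: An $N$-series of a group $G$ is a descending chain of subgroups $G=H_1\ge H_2\ge\cdots$ with $[H_a,H_b]\le H_{a+b}$. For $m\ge1$, $A_m\subseteq\mathbf Z[G]$ is the additive subgroup generated by all products $(x_1-1)\cdots(x_r-1)$ with $x_\nu\in H_{a_\nu}$ and $\sum_\nu a_\nu\ge m$ (it is a two-sided ideal). The homomorphism $\phi_n:H_n/H_{n+1}\to A_n/A_{n+1}$ is $hH_{n+1}\mapsto (h-1)+A_{n+1}$. Put $E_n=G/H_{n+1}$, $Q_n=G/H_n$, $C_n=H_n/H_{n+1}$, and let $\pi_n:E_n\to Q_n$ be the projection, a central extension with kernel $C_n$. For a group $Q$, $\overline C_r(Q)$ is the free abelian group on symbols $[q_1|\cdots|q_r]$ with all $q_i\ne1$ (symbols containing an identity are interpreted as $0$), with the normalized bar boundary with trivial integral coefficients $$\partial[q_1|\cdots|q_r]=[q_2|\cdots|q_r]+\sum_{i=1}^{r-1}(-1)^i[q_1|\cdots|q_iq_{i+1}|\cdots|q_r]+(-1)^r[q_1|\cdots|q_{r-1}].$$ $Z_2(Q)=\ker(\partial:\overline C_2(Q)\to\overline C_1(Q))$. The chain map induced by $\pi_n$ is $(\pi_n)_\#$. Choose a normalized set-theoretic section $s_n:Q_n\to E_n$ and let $\alpha_n(q,q')=s_n(q)s_n(q')s_n(qq')^{-1}\in C_n$.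 Let $\vartheta_{n,s}:\overline C_2(Q_n)\to A_n/A_{n+1}$ be the homomorphism $[q|q']\mapsto(\widetilde\alpha_n(q,q')-1)+A_{n+1}$, where $\widetilde\alpha_n(q,q')\in H_n$ represents $\alpha_n(q,q')$. Put $D_n^{\rm bar}=\ker(\vartheta_{n,s}|_{Z_2(Q_n)})\subseteq Z_2(Q_n)$ (independent of the choice of $s_n$). Define $$L_n^{\rm bar}=\{(z_E,c_Q)\in Z_2(E_n)\oplus\overline C_3(Q_n):(\pi_n)_\#z_E+\partial c_Q\in D_n^{\rm bar}\}$$ and $R_n^{\rm bar}:L_n^{\rm bar}\to D_n^{\rm bar}$, $R_n^{\rm bar}(z_E,c_Q)=(\pi_n)_\#z_E+\partial c_Q$. *)

theory Defs
  imports "HOL-Algebra.Algebra"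
begin

definition commutator_subgroup :: "('a, 'b) monoid_scheme \<Rightarrow> 'a set \<Rightarrow> 'a set \<Rightarrow> 'a set" where
  "commutator_subgroup G A B =
     generate G {x \<otimes>\<^bsub>G\<^esub> y \<otimes>\<^bsub>G\<^esub> inv\<^bsub>G\<^esub> x \<otimes>\<^bsub>G\<^esub> inv\<^bsub>G\<^esub> y | x y. x \<in> A \<and> y \<in> B}"

text \<open>The series is indexed from 1; the value at index 0 is irrelevant.\<close>
definition N_series :: "('a, 'b) monoid_scheme \<Rightarrow> (nat \<Rightarrow> 'a set) \<Rightarrow> bool" where
  "N_series G H \<longleftrightarrow>
     H 1 = carrier G \<and>
     (\<forall>a\<ge>1. subgroup (H a) G) \<and>
     (\<forall>a\<ge>1. H (Suc a) \<subseteq> H a) \<and>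
     (\<forall>a\<ge>1. \<forall>b\<ge>1. commutator_subgroup G (H a) (H b) \<subseteq> H (a + b))"

text \<open>The group ring \<open>\<int>[G]\<close> on finitely supported functions, with convolution as product.\<close>
definition group_ring :: "('a, 'b) monoid_scheme \<Rightarrow> ('a \<Rightarrow>\<^sub>0 int) ring" where
  "group_ring G =
     \<lparr>carrier = carrier (free_Abelian_group (carrier G)),
      monoid.mult = (\<lambda>u v. frag_extend (\<lambda>g. frag_extend (\<lambda>h. frag_of (g \<otimes>\<^bsub>G\<^esub> h)) v) u),
      one = frag_of \<one>\<^bsub>G\<^esub>,
      ring.zero = 0,
      ring.add = (+)\<rparr>"

definition gr_diff :: "('a, 'b) monoid_scheme \<Rightarrow> 'a \<Rightarrow> ('a \<Rightarrow>\<^sub>0 int)" where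
  "gr_diff G x = frag_of x \<ominus>\<^bsub>group_ring G\<^esub> \<one>\<^bsub>group_ring G\<^esub>"

text \<open>A factor \<open>x - 1\<close> with \<open>x \<in> H a\<close> is recorded as the pair \<open>(a, x)\<close>, \<open>a \<ge> 1\<close>.\<close>
definition A_filt :: "('a, 'b) monoid_scheme \<Rightarrow> (nat \<Rightarrow> 'a set) \<Rightarrow> nat \<Rightarrow> ('a \<Rightarrow>\<^sub>0 int) set" where
  "A_filt G H m =
     generate (add_monoid (group_ring G))
       {foldr (\<otimes>\<^bsub>group_ring G\<^esub>) (map (\<lambda>(a, x). gr_diff G x) ps) \<one>\<^bsub>group_ring G\<^esub> | ps.
          (\<forall>(a, x)\<in>set ps. 1 \<le> a \<and> x \<in> H a) \<and> m \<le> sum_list (map fst ps)}"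

definition A_gr :: "('a, 'b) monoid_scheme \<Rightarrow> (nat \<Rightarrow> 'a set) \<Rightarrow> nat \<Rightarrow> ('a \<Rightarrow>\<^sub>0 int) set monoid" where
  "A_gr G H n = ((add_monoid (group_ring G))\<lparr>carrier := A_filt G H n\<rparr>) Mod A_filt G H (Suc n)"

definition E_grp :: "('a, 'b) monoid_scheme \<Rightarrow> (nat \<Rightarrow> 'a set) \<Rightarrow> nat \<Rightarrow> 'a set monoid" where
  "E_grp G H n = G Mod H (Suc n)"

definition Q_grp :: "('a, 'b) monoid_scheme \<Rightarrow> (nat \<Rightarrow> 'a set) \<Rightarrow> nat \<Rightarrow> 'a set monoid" where
  "Q_grp G H n = G Mod H n"

text \<open>Elements of C are cosets of \<open>H (n+1)\<close>, so C is literally contained in E.\<close>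
definition C_grp :: "('a, 'b) monoid_scheme \<Rightarrow> (nat \<Rightarrow> 'a set) \<Rightarrow> nat \<Rightarrow> 'a set monoid" where
  "C_grp G H n = (G\<lparr>carrier := H n\<rparr>) Mod H (Suc n)"

text \<open>\<open>H\<^sub>n (H\<^sub>n\<^sub>+\<^sub>1 g) = H\<^sub>n g\<close>, so this is the canonical projection from E to Q.\<close>
definition proj_EQ :: "('a, 'b) monoid_scheme \<Rightarrow> (nat \<Rightarrow> 'a set) \<Rightarrow> nat \<Rightarrow> 'a set \<Rightarrow> 'a set" where
  "proj_EQ G H n U = H n <#>\<^bsub>G\<^esub> U"

text \<open>For \<open>U\<close> in C, the class of \<open>h - 1\<close> is the same for all representatives \<open>h \<in> U\<close>.\<close>
definition phi :: "('a, 'b) monoid_scheme \<Rightarrow> (nat \<Rightarrow> 'a set) \<Rightarrow> nat \<Rightarrow> 'a set \<Rightarrow> ('a \<Rightarrow>\<^sub>0 int) set" where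
  "phi G H n U =
     the_elem ((\<lambda>h. A_filt G H (Suc n) #>\<^bsub>add_monoid (group_ring G)\<^esub> gr_diff G h) ` U)"

definition ker_phi :: "('a, 'b) monoid_scheme \<Rightarrow> (nat \<Rightarrow> 'a set) \<Rightarrow> nat \<Rightarrow> 'a set monoid" where
  "ker_phi G H n =
     (C_grp G H n)\<lparr>carrier := kernel (C_grp G H n) (A_gr G H n) (phi G H n)\<rparr>"

definition bar_chains :: "('c, 'd) monoid_scheme \<Rightarrow> nat \<Rightarrow> ('c list \<Rightarrow>\<^sub>0 int) monoid" where
  "bar_chains Q r =
     free_Abelian_group {qs. length qs = r \<and> set qs \<subseteq> carrier Q - {\<one>\<^bsub>Q\<^esub>}}"

definition bar_symbol :: "('c, 'd) monoid_scheme \<Rightarrow> 'c list \<Rightarrow> ('c list \<Rightarrow>\<^sub>0 int)" where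
  "bar_symbol Q qs = (if \<one>\<^bsub>Q\<^esub> \<in> set qs then 0 else frag_of qs)"

text \<open>The boundary in degrees \<open>r \<ge> 1\<close>. Lists are indexed from 0, so \<open>q\<^sub>i\<close> is \<open>qs ! (i - 1)\<close>.\<close>
definition bar_boundary :: "('c, 'd) monoid_scheme \<Rightarrow> ('c list \<Rightarrow>\<^sub>0 int) \<Rightarrow> ('c list \<Rightarrow>\<^sub>0 int)" where
  "bar_boundary Q =
     frag_extend (\<lambda>qs.
       bar_symbol Q (tl qs)
       + (\<Sum>i = 1..<length qs. frag_cmul ((- 1) ^ i)
            (bar_symbol Q (take (i - 1) qs @ [qs ! (i - 1) \<otimes>\<^bsub>Q\<^esub> qs ! i] @ drop (i + 1) qs)))
       + frag_cmul ((- 1) ^ length qs) (bar_symbol Q (butlast qs)))"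

definition bar_Z2 :: "('c, 'd) monoid_scheme \<Rightarrow> ('c list \<Rightarrow>\<^sub>0 int) monoid" where
  "bar_Z2 Q =
     (bar_chains Q 2)\<lparr>carrier := kernel (bar_chains Q 2) (bar_chains Q 1) (bar_boundary Q)\<rparr>"

definition bar_map :: "('e, 'f) monoid_scheme \<Rightarrow> ('c \<Rightarrow> 'e) \<Rightarrow> ('c list \<Rightarrow>\<^sub>0 int) \<Rightarrow> ('e list \<Rightarrow>\<^sub>0 int)" where
  "bar_map Q f = frag_extend (\<lambda>es. bar_symbol Q (map f es))"

definition normalized_section ::
  "('a, 'b) monoid_scheme \<Rightarrow> (nat \<Rightarrow> 'a set) \<Rightarrow> nat \<Rightarrow> ('a set \<Rightarrow> 'a set) \<Rightarrow> bool" where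
  "normalized_section G H n s \<longleftrightarrow>
     s \<in> carrier (Q_grp G H n) \<rightarrow> carrier (E_grp G H n) \<and>
     (\<forall>q\<in>carrier (Q_grp G H n). proj_EQ G H n (s q) = q) \<and>
     s \<one>\<^bsub>Q_grp G H n\<^esub> = \<one>\<^bsub>E_grp G H n\<^esub>"

definition alpha ::
  "('a, 'b) monoid_scheme \<Rightarrow> (nat \<Rightarrow> 'a set) \<Rightarrow> nat \<Rightarrow> ('a set \<Rightarrow> 'a set)
     \<Rightarrow> 'a set \<Rightarrow> 'a set \<Rightarrow> 'a set" where
  "alpha G H n s q q' =
     s q \<otimes>\<^bsub>E_grp G H n\<^esub> s q' \<otimes>\<^bsub>E_grp G H n\<^esub> inv\<^bsub>E_grp G H n\<^esub> (s (q \<otimes>\<^bsub>Q_grp G H n\<^esub> q'))"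

text \<open>The class of \<open>\<alpha>~(q,q') - 1\<close>, for a representative \<open>\<alpha>~(q,q')\<close> of \<open>\<alpha>(q,q')\<close>, is
  \<open>phi (\<alpha>(q,q'))\<close>; it is extended linearly from the basis of symbols. The target group is
  written multiplicatively, so a linear combination becomes a product of integer powers.\<close>
definition vartheta ::
  "('a, 'b) monoid_scheme \<Rightarrow> (nat \<Rightarrow> 'a set) \<Rightarrow> nat \<Rightarrow> ('a set \<Rightarrow> 'a set)
     \<Rightarrow> ('a set list \<Rightarrow>\<^sub>0 int) \<Rightarrow> ('a \<Rightarrow>\<^sub>0 int) set" where
  "vartheta G H n s c =
     finprod (A_gr G H n)
       (\<lambda>qs. phi G H n (alpha G H n s (qs ! 0) (qs ! 1))
               [^]\<^bsub>A_gr G H n\<^esub> Poly_Mapping.lookup c qs)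
       (Poly_Mapping.keys c)"

definition D_bar ::
  "('a, 'b) monoid_scheme \<Rightarrow> (nat \<Rightarrow> 'a set) \<Rightarrow> nat \<Rightarrow> ('a set \<Rightarrow> 'a set)
     \<Rightarrow> ('a set list \<Rightarrow>\<^sub>0 int) monoid" where
  "D_bar G H n s =
     (bar_Z2 (Q_grp G H n))
       \<lparr>carrier := kernel (bar_Z2 (Q_grp G H n)) (A_gr G H n) (vartheta G H n s)\<rparr>"

definition R_bar ::
  "('a, 'b) monoid_scheme \<Rightarrow> (nat \<Rightarrow> 'a set) \<Rightarrow> nat
     \<Rightarrow> ('a set list \<Rightarrow>\<^sub>0 int) \<times> ('a set list \<Rightarrow>\<^sub>0 int) \<Rightarrow> ('a set list \<Rightarrow>\<^sub>0 int)" where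
  "R_bar G H n = (\<lambda>(z, c).
     bar_map (Q_grp G H n) (proj_EQ G H n) z + bar_boundary (Q_grp G H n) c)"

definition L_bar ::
  "('a, 'b) monoid_scheme \<Rightarrow> (nat \<Rightarrow> 'a set) \<Rightarrow> nat \<Rightarrow> ('a set \<Rightarrow> 'a set)
     \<Rightarrow> (('a set list \<Rightarrow>\<^sub>0 int) \<times> ('a set list \<Rightarrow>\<^sub>0 int)) monoid" where
  "L_bar G H n s =
     (bar_Z2 (E_grp G H n) \<times>\<times> bar_chains (Q_grp G H n) 3)
       \<lparr>carrier := {p \<in> carrier (bar_Z2 (E_grp G H n) \<times>\<times> bar_chains (Q_grp G H n) 3).
                     R_bar G H n p \<in> carrier (D_bar G H n s)}\<rparr>"

definition coker :: "('c, 'd) monoid_scheme \<Rightarrow> ('e, 'f) monoid_scheme \<Rightarrow> ('c \<Rightarrow> 'e) \<Rightarrow> 'e set monoid" where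
  "coker K M f = M Mod (f ` carrier K)"

lemma N_series_normal:
  assumes "group G" "N_series G H" "1 \<le> a"
  shows "H a \<lhd> G"
proof -
  interpret group G by fact
  have sub: "subgroup (H a) G" and dec: "H (Suc a) \<subseteq> H a" and one: "H 1 = carrier G"
    and "commutator_subgroup G (H 1) (H a) \<subseteq> H (1 + a)"
    using assms(2,3) unfolding N_series_def by blast+
  hence com: "commutator_subgroup G (H 1) (H a) \<subseteq> H a" by auto
  have "x \<otimes>\<^bsub>G\<^esub> h \<otimes>\<^bsub>G\<^esub> inv\<^bsub>G\<^esub> x \<in> H a" if "x \<in> carrier G" "h \<in> H a" for x h
  proof -
    have h: "h \<in> carrier G" using subgroup.subset[OF sub] that by auto
    have "x \<otimes>\<^bsub>G\<^esub> h \<otimes>\<^bsub>G\<^esub> inv\<^bsub>G\<^esub> x \<otimes>\<^bsub>G\<^esub> inv\<^bsub>G\<^esub> h \<in> commutator_subgroup G (H 1) (H a)"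
      unfolding commutator_subgroup_def one using that by (intro generate.incl) blast
    hence "x \<otimes>\<^bsub>G\<^esub> h \<otimes>\<^bsub>G\<^esub> inv\<^bsub>G\<^esub> x \<otimes>\<^bsub>G\<^esub> inv\<^bsub>G\<^esub> h \<in> H a" using com by auto
    hence "x \<otimes>\<^bsub>G\<^esub> h \<otimes>\<^bsub>G\<^esub> inv\<^bsub>G\<^esub> x \<otimes>\<^bsub>G\<^esub> inv\<^bsub>G\<^esub> h \<otimes>\<^bsub>G\<^esub> h \<in> H a"
      using subgroup.m_closed[OF sub] that by blast
    thus ?thesis using h that by (simp add: m_assoc)
  qed
  thus ?thesis using sub by (auto simp: normal_inv_iff)
qed

lemma proj_EQ_coset:
  assumes "group G" "N_series G H" "1 \<le> n" "g \<in> carrier G"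
  shows "proj_EQ G H n (H (Suc n) #>\<^bsub>G\<^esub> g) = H n #>\<^bsub>G\<^esub> g"
proof -
  interpret group G by fact
  have s: "subgroup (H n) G" "subgroup (H (Suc n)) G" "H (Suc n) \<subseteq> H n"
    using assms(2,3) unfolding N_series_def by auto
  have cl: "H n \<subseteq> carrier G" using s(1) by (rule subgroup.subset)
  have "H n <#>\<^bsub>G\<^esub> H (Suc n) = H n"
  proof
    show "H n <#>\<^bsub>G\<^esub> H (Suc n) \<subseteq> H n"
      using s subgroup.m_closed[OF s(1)] by (auto simp: set_mult_def)
    show "H n \<subseteq> H n <#>\<^bsub>G\<^esub> H (Suc n)"
    proof
      fix h assume h: "h \<in> H n"
      have "h = h \<otimes>\<^bsub>G\<^esub> \<one>\<^bsub>G\<^esub>" using h cl by auto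
      thus "h \<in> H n <#>\<^bsub>G\<^esub> H (Suc n)"
        using h subgroup.one_closed[OF s(2)] unfolding set_mult_def by blast
    qed
  qed
  thus ?thesis unfolding proj_EQ_def
    using s(3) cl assms(4) by (metis setmult_rcos_assoc subset_trans)
qed

lemma normalized_section_exists:
  assumes "group G" "N_series G H" "1 \<le> n"
  shows "\<exists>s. normalized_section G H n s"
proof -
  interpret group G by fact
  have s: "H n \<subseteq> carrier G" "H (Suc n) \<subseteq> carrier G"
    using assms(2,3) unfolding N_series_def by (auto dest: subgroup.subset)
  have one: "proj_EQ G H n \<one>\<^bsub>E_grp G H n\<^esub> = \<one>\<^bsub>Q_grp G H n\<^esub>"
    using proj_EQ_coset[OF assms one_closed] s
    by (simp add: E_grp_def Q_grp_def FactGroup_def)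
  have "H (Suc n) \<in> rcosets\<^bsub>G\<^esub> H (Suc n)"
    using rcosetsI[OF s(2) one_closed] s by simp
  hence oneE: "\<one>\<^bsub>E_grp G H n\<^esub> \<in> carrier (E_grp G H n)"
    by (simp add: E_grp_def FactGroup_def)
  have "\<exists>e\<in>carrier (E_grp G H n). proj_EQ G H n e = q" if "q \<in> carrier (Q_grp G H n)" for q
    using that proj_EQ_coset[OF assms] unfolding E_grp_def Q_grp_def FactGroup_def RCOSETS_def
    by auto
  then obtain t where t: "\<And>q. q \<in> carrier (Q_grp G H n) \<Longrightarrow>
      t q \<in> carrier (E_grp G H n) \<and> proj_EQ G H n (t q) = q" by metis
  have "normalized_section G H n (t(\<one>\<^bsub>Q_grp G H n\<^esub> := \<one>\<^bsub>E_grp G H n\<^esub>))"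
    unfolding normalized_section_def using t one oneE by auto
  thus ?thesis by blast
qed

end

theory Submission
  imports Defs
begin

text \<open>
  Choosing a section of the central extension \<open>E \<rightarrow> Q\<close> turns the extension cocycle into a map \<open>\<tau>\<close> from
  \<open>2\<close>-chains of \<open>Q\<close> to \<open>C\<close>, and \<open>\<vartheta> = \<phi> \<circ> \<tau>\<close>. Hence \<open>\<tau>\<close> maps \<open>D\<close> into \<open>ker \<phi>\<close>, and the isomorphism is
  the one induced by \<open>\<tau>\<close>. Its kernel is given by the exactness of \<open>Z\<^sub>2(E) \<rightarrow> Z\<^sub>2(Q) \<rightarrow> C\<close>, shown by lifting
  cycles through the section; boundaries of \<open>3\<close>-chains of \<open>Q\<close> are killed by \<open>\<tau>\<close> because of the cocycle
  identity. For surjectivity, if \<open>h - 1\<close> lies in \<open>A\<^sub>n\<^sub>+\<^sub>1\<close>, then, since products of two factors \<open>x - 1\<close> die in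
  \<open>H\<^sub>1(E)\<close>, the class of \<open>h\<close> in \<open>E\<close> bounds a \<open>2\<close>-chain, whose projection to \<open>Q\<close> is a cycle with
  value \<open>h\<^sup>-\<^sup>1\<close> under \<open>\<tau>\<close>.
\<close>

section \<open>Free abelian groups and bar chains\<close>

text \<open>The homomorphism from a free abelian group with prescribed values on generators, for a
  target written multiplicatively. It has the shape of \<open>vartheta\<close>, with target and
  values left free so that it can be taken in \<open>C\<close> as well as in
  \<open>A\<close>.\<close>

definition frag_prod :: "('c, 'd) monoid_scheme \<Rightarrow> ('e \<Rightarrow> 'c) \<Rightarrow> ('e \<Rightarrow>\<^sub>0 int) \<Rightarrow> 'c" where
  "frag_prod K f c =
     finprod K (\<lambda>x. f x [^]\<^bsub>K\<^esub> Poly_Mapping.lookup c x) (Poly_Mapping.keys c)"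

context comm_group
begin

text \<open>Off the support the exponent is 0, so a larger index set adds only trivial factors. This
  allows \<open>x\<close>, \<open>y\<close> and \<open>x + y\<close> to be compared over one common
  set.\<close>

lemma frag_prod_superset:
  assumes "finite T" "Poly_Mapping.keys c \<subseteq> T" "f ` T \<subseteq> carrier G"
  shows "frag_prod G f c = finprod G (\<lambda>x. f x [^] Poly_Mapping.lookup c x) T"
  unfolding frag_prod_def
  by (rule finprod_mono_neutral_cong_left)
    (use assms in \<open>auto simp: in_keys_iff intro!: int_pow_closed\<close>)

lemma frag_prod_hom:
  assumes "f ` S \<subseteq> carrier G"
  shows "frag_prod G f \<in> hom (free_Abelian_group S) G"
proof (rule homI)
  fix x assume "x \<in> carrier (free_Abelian_group S)"
  then show "frag_prod G f x \<in> carrier G"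
    using assms unfolding frag_prod_def by (auto intro!: finprod_closed int_pow_closed)
next
  fix x y assume "x \<in> carrier (free_Abelian_group S)" "y \<in> carrier (free_Abelian_group S)"
  then have S: "Poly_Mapping.keys x \<union> Poly_Mapping.keys y \<subseteq> S" by simp
  let ?T = "Poly_Mapping.keys x \<union> Poly_Mapping.keys y"
  have T: "finite ?T" "f ` ?T \<subseteq> carrier G" using S assms by auto
  have "frag_prod G f (x + y) = finprod G (\<lambda>i. f i [^] Poly_Mapping.lookup (x + y) i) ?T"
    using T keys_add[of x y] by (intro frag_prod_superset) blast+
  also have "\<dots> = finprod G (\<lambda>i. f i [^] Poly_Mapping.lookup x i \<otimes> f i [^] Poly_Mapping.lookup y i) ?T"
    using T by (intro finprod_cong') (auto simp: lookup_add int_pow_mult image_subset_iff)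
  also have "\<dots> = finprod G (\<lambda>i. f i [^] Poly_Mapping.lookup x i) ?T
      \<otimes> finprod G (\<lambda>i. f i [^] Poly_Mapping.lookup y i) ?T"
    using T by (intro finprod_multf) (auto simp: image_subset_iff)
  also have "\<dots> = frag_prod G f x \<otimes> frag_prod G f y"
    using T frag_prod_superset[of ?T x f] frag_prod_superset[of ?T y f] by simp
  finally show "frag_prod G f (x \<otimes>\<^bsub>free_Abelian_group S\<^esub> y) = frag_prod G f x \<otimes> frag_prod G f y"
    by simp
qed

context
  fixes f :: "'e \<Rightarrow> 'a" and S
  assumes f: "f ` S \<subseteq> carrier G"
begin

interpretation frag_prod: group_hom "free_Abelian_group S" G "frag_prod G f"
  using frag_prod_hom[OF f] by (simp add: group_hom_def group_hom_axioms_def is_group)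

lemma frag_prod_closed: "Poly_Mapping.keys x \<subseteq> S \<Longrightarrow> frag_prod G f x \<in> carrier G"
  using frag_prod.hom_closed by simp

lemma frag_prod_zero: "frag_prod G f 0 = \<one>"
  using frag_prod.hom_one by simp

lemma frag_prod_of: "x \<in> S \<Longrightarrow> frag_prod G f (frag_of x) = f x"
  using f by (auto simp: frag_prod_def finprod_singleton image_subset_iff)

lemma frag_prod_add:
  "Poly_Mapping.keys x \<subseteq> S \<Longrightarrow> Poly_Mapping.keys y \<subseteq> S \<Longrightarrow>
    frag_prod G f (x + y) = frag_prod G f x \<otimes> frag_prod G f y"
  using frag_prod.hom_mult by simp

lemma frag_prod_minus:
  "Poly_Mapping.keys x \<subseteq> S \<Longrightarrow> frag_prod G f (- x) = inv (frag_prod G f x)"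
  using frag_prod.hom_inv[of x] by simp

lemma frag_prod_diff:
  "Poly_Mapping.keys x \<subseteq> S \<Longrightarrow> Poly_Mapping.keys y \<subseteq> S \<Longrightarrow>
    frag_prod G f (x - y) = frag_prod G f x \<otimes> inv (frag_prod G f y)"
  using frag_prod_add[of x "- y"] frag_prod_minus[of y] by simp

end

end

text \<open>Homomorphisms on a free abelian group that agree on generators are equal. Applied to
  \<phi>, this gives \<vartheta> = \<phi> \<circ> \<tau>.\<close>

lemma hom_frag_prod:
  assumes "comm_group K" "comm_group L" "h \<in> hom K L" "f ` S \<subseteq> carrier K"
    and "Poly_Mapping.keys c \<subseteq> S"
  shows "h (frag_prod K f c) = frag_prod L (\<lambda>x. h (f x)) c"
proof -
  interpret K: comm_group K by fact
  interpret L: comm_group L by fact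
  interpret group_hom K L h
    using assms(3) by unfold_locales
  have hf: "(\<lambda>x. h (f x)) ` S \<subseteq> carrier L" using assms(4) by auto
  show ?thesis using assms(5)
  proof (induction rule: free_Abelian_group_induct[consumes 1, case_names zero diff one])
    case zero
    show ?case by (simp add: K.frag_prod_zero[OF assms(4)] L.frag_prod_zero[OF hf])
  next
    case (diff x y)
    then show ?case
      by (simp add: K.frag_prod_diff[OF assms(4)] L.frag_prod_diff[OF hf] K.frag_prod_closed[OF assms(4)])
  next
    case (one x)
    then show ?case by (simp add: K.frag_prod_of[OF assms(4)] L.frag_prod_of[OF hf])
  qed
qed

lemma keys_add_subset:
  "Poly_Mapping.keys x \<subseteq> S \<Longrightarrow> Poly_Mapping.keys y \<subseteq> S \<Longrightarrow> Poly_Mapping.keys (x + y) \<subseteq> S"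
  using keys_add[of x y] by blast

lemma keys_diff_subset:
  "Poly_Mapping.keys x \<subseteq> S \<Longrightarrow> Poly_Mapping.keys y \<subseteq> S \<Longrightarrow> Poly_Mapping.keys (x - y) \<subseteq> S"
  using keys_diff[of x y] by blast

lemma keys_frag_extend_subset:
  assumes "\<And>x. x \<in> Poly_Mapping.keys c \<Longrightarrow> Poly_Mapping.keys (f x) \<subseteq> T"
  shows "Poly_Mapping.keys (frag_extend f c) \<subseteq> T"
  using keys_frag_extend[of f c] assms by blast

section \<open>The normalized bar complex in low degrees\<close>

definition bar_cells :: "('c, 'd) monoid_scheme \<Rightarrow> nat \<Rightarrow> 'c list set" where
  "bar_cells Q r = {qs. length qs = r \<and> set qs \<subseteq> carrier Q - {\<one>\<^bsub>Q\<^esub>}}"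

lemma bar_chains_eq: "bar_chains Q r = free_Abelian_group (bar_cells Q r)"
  by (simp add: bar_chains_def bar_cells_def)

lemma bar_cells_2: "qs \<in> bar_cells Q 2 \<longleftrightarrow>
    (\<exists>a b. qs = [a, b] \<and> a \<in> carrier Q \<and> a \<noteq> \<one>\<^bsub>Q\<^esub> \<and> b \<in> carrier Q \<and> b \<noteq> \<one>\<^bsub>Q\<^esub>)"
  by (auto simp: bar_cells_def numeral_2_eq_2 length_Suc_conv)

lemma bar_cells_3: "qs \<in> bar_cells Q 3 \<longleftrightarrow>
    (\<exists>a b c. qs = [a, b, c] \<and> a \<in> carrier Q \<and> a \<noteq> \<one>\<^bsub>Q\<^esub> \<and> b \<in> carrier Q \<and> b \<noteq> \<one>\<^bsub>Q\<^esub>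
      \<and> c \<in> carrier Q \<and> c \<noteq> \<one>\<^bsub>Q\<^esub>)"
  by (auto simp: bar_cells_def numeral_3_eq_3 length_Suc_conv)

lemma bar_symbol_of_cell: "qs \<in> bar_cells Q r \<Longrightarrow> bar_symbol Q qs = frag_of qs"
  by (auto simp: bar_symbol_def bar_cells_def)

lemma keys_bar_symbol:
  "length qs = r \<Longrightarrow> set qs \<subseteq> carrier Q \<Longrightarrow> Poly_Mapping.keys (bar_symbol Q qs) \<subseteq> bar_cells Q r"
  by (auto simp: bar_symbol_def bar_cells_def)

lemma bar_boundary_zero: "bar_boundary Q 0 = 0"
  and bar_boundary_add: "bar_boundary Q (x + y) = bar_boundary Q x + bar_boundary Q y"
  and bar_boundary_diff: "bar_boundary Q (x - y) = bar_boundary Q x - bar_boundary Q y"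
  and bar_boundary_minus: "bar_boundary Q (- x) = - bar_boundary Q x"
  by (simp_all add: bar_boundary_def frag_extend_add frag_extend_diff frag_extend_minus)

lemma bar_map_zero: "bar_map Q f 0 = 0"
  and bar_map_add: "bar_map Q f (x + y) = bar_map Q f x + bar_map Q f y"
  and bar_map_diff: "bar_map Q f (x - y) = bar_map Q f x - bar_map Q f y"
  by (simp_all add: bar_map_def frag_extend_add frag_extend_diff)

text \<open>Only preservation of the identity is asked of \<open>f\<close>, so the rule also covers
  the section \<open>s\<close>, which need not be a homomorphism.\<close>

lemma bar_map_symbol:
  "f \<one>\<^bsub>E\<^esub> = \<one>\<^bsub>Q\<^esub> \<Longrightarrow> bar_map Q f (bar_symbol E es) = bar_symbol Q (map f es)"
  by (force simp: bar_map_def bar_symbol_def)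

lemma keys_bar_map:
  assumes "f \<in> carrier E \<rightarrow> carrier Q" "Poly_Mapping.keys c \<subseteq> bar_cells E r"
  shows "Poly_Mapping.keys (bar_map Q f c) \<subseteq> bar_cells Q r"
  unfolding bar_map_def
  by (intro keys_frag_extend_subset keys_bar_symbol)
    (use assms in \<open>force simp: bar_cells_def\<close>)+

context group
begin

text \<open>Degenerate symbols are included: if \<open>a\<close> or \<open>b\<close> is \<one>, the
  right side cancels to 0. Later computations can thus treat all symbols alike.\<close>

lemma bar_boundary_symbol2:
  assumes "a \<in> carrier G" "b \<in> carrier G"
  shows "bar_boundary G (bar_symbol G [a, b])
    = bar_symbol G [b] - bar_symbol G [a \<otimes> b] + bar_symbol G [a]"
  using assms
  by (cases "a = \<one>"; cases "b = \<one>") (simp_all add: bar_boundary_def bar_symbol_def)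

lemma bar_boundary_of3:
  "bar_boundary G (frag_of [a, b, c])
    = bar_symbol G [b, c] - bar_symbol G [a \<otimes> b, c] + bar_symbol G [a, b \<otimes> c] - bar_symbol G [a, b]"
  by (simp add: bar_boundary_def numeral_3_eq_3 numeral_2_eq_2)

lemma keys_bar_boundary2:
  assumes "Poly_Mapping.keys c \<subseteq> bar_cells G 2"
  shows "Poly_Mapping.keys (bar_boundary G c) \<subseteq> bar_cells G 1"
  using assms
proof (induction rule: free_Abelian_group_induct[consumes 1, case_names zero diff one])
  case (diff x y)
  then show ?case by (simp add: bar_boundary_diff keys_diff_subset)
next
  case (one qs)
  then obtain a b where ab: "qs = [a, b]" "a \<in> carrier G" "b \<in> carrier G"
    by (auto simp: bar_cells_2)
  then have "bar_boundary G (frag_of qs) = bar_symbol G [b] - bar_symbol G [a \<otimes> b] + bar_symbol G [a]"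
    using bar_boundary_symbol2[of a b] bar_symbol_of_cell[OF one] by simp
  moreover have "Poly_Mapping.keys (bar_symbol G [x]) \<subseteq> bar_cells G 1" if "x \<in> carrier G" for x
    using that by (intro keys_bar_symbol) auto
  ultimately show ?case
    using ab by (simp add: keys_add_subset keys_diff_subset)
qed (simp add: bar_boundary_zero)

lemma keys_bar_boundary3:
  assumes "Poly_Mapping.keys c \<subseteq> bar_cells G 3"
  shows "Poly_Mapping.keys (bar_boundary G c) \<subseteq> bar_cells G 2"
  using assms
proof (induction rule: free_Abelian_group_induct[consumes 1, case_names zero diff one])
  case (diff x y)
  then show ?case by (simp add: bar_boundary_diff keys_diff_subset)
next
  case (one qs)
  then obtain a b c where abc: "qs = [a, b, c]" "a \<in> carrier G" "b \<in> carrier G" "c \<in> carrier G"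
    by (auto simp: bar_cells_3)
  have "Poly_Mapping.keys (bar_symbol G [x, y]) \<subseteq> bar_cells G 2"
    if "x \<in> carrier G" "y \<in> carrier G" for x y
    using that by (intro keys_bar_symbol) auto
  then show ?case unfolding abc(1) bar_boundary_of3
    using abc by (simp add: keys_add_subset keys_diff_subset)
qed (simp add: bar_boundary_zero)

end

lemma (in group_hom) bar_boundary_bar_map:
  assumes "Poly_Mapping.keys c \<subseteq> bar_cells G 2"
  shows "bar_boundary H (bar_map H h c) = bar_map H h (bar_boundary G c)"
  using assms
proof (induction rule: free_Abelian_group_induct[consumes 1, case_names zero diff one])
  case (one qs)
  then obtain a b where ab: "qs = [a, b]" "a \<in> carrier G" "b \<in> carrier G"
    by (auto simp: bar_cells_2)
  then show ?case
    unfolding bar_symbol_of_cell[OF one, symmetric]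
    by (simp add: G.bar_boundary_symbol2 H.bar_boundary_symbol2 bar_map_symbol bar_map_add bar_map_diff)
qed (simp_all add: bar_boundary_zero bar_map_zero bar_boundary_diff bar_map_diff)

section \<open>The transgression of a central extension\<close>

text \<open>No series enters here, only a homomorphism with central kernel and a normalized section;
  surjectivity of \<open>p\<close> is implied by \<open>proj_section\<close>.\<close>

locale central_extension = group_hom E Q p
  for E (structure) and Q and p +
  fixes s
  assumes central: "c \<in> kernel E Q p \<Longrightarrow> e \<in> carrier E \<Longrightarrow> c \<otimes> e = e \<otimes> c"
    and section_closed: "q \<in> carrier Q \<Longrightarrow> s q \<in> carrier E"
    and proj_section: "q \<in> carrier Q \<Longrightarrow> p (s q) = q"
    and section_one: "s \<one>\<^bsub>Q\<^esub> = \<one>"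
begin

abbreviation C where "C \<equiv> E\<lparr>carrier := kernel E Q p\<rparr>"

definition cocycle where
  "cocycle q q' = s q \<otimes> s q' \<otimes> inv (s (q \<otimes>\<^bsub>Q\<^esub> q'))"

text \<open>The central component of \<open>e\<close> relative to the section:
  \<open>e = s (p e) \<otimes> defect e\<close>.\<close>

definition defect where
  "defect e = inv (s (p e)) \<otimes> e"

text \<open>Up to sign, its restriction to cycles induces the map from H_2(Q) to C in the five-term
  exact sequence.\<close>

definition transgression where
  "transgression = frag_prod C (\<lambda>qs. cocycle (qs ! 0) (qs ! 1))"

definition defect_chain where
  "defect_chain = frag_prod C (\<lambda>es. defect (es ! 0))"

lemma C_subgroup: "subgroup (kernel E Q p) E"
  by (rule subgroup_kernel)

lemma C_carrier: "c \<in> kernel E Q p \<Longrightarrow> c \<in> carrier E"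
  by (simp add: kernel_def)

lemma C_comm_group: "comm_group C"
proof (rule group.group_comm_groupI)
  show "group C" using C_subgroup G.subgroup_imp_group by blast
qed (simp add: central C_carrier)

lemma C_inv: "c \<in> kernel E Q p \<Longrightarrow> inv\<^bsub>C\<^esub> c = inv c"
  using G.m_inv_consistent[OF C_subgroup] by simp

text \<open>The rewrites make the laws of \<open>C\<close> apply to products written in
  \<open>E\<close>; inverses are translated by \<open>C_inv\<close>.\<close>

sublocale C: comm_group C
  rewrites "carrier C = kernel E Q p" and "\<one>\<^bsub>C\<^esub> = \<one>" and "monoid.mult C = monoid.mult E"
  by (rule C_comm_group) simp_all

lemma C_inv_closed: "c \<in> kernel E Q p \<Longrightarrow> inv c \<in> kernel E Q p"
  by (rule subgroup.m_inv_closed[OF C_subgroup])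

lemma C_inv_mult:
  "c \<in> kernel E Q p \<Longrightarrow> d \<in> kernel E Q p \<Longrightarrow> inv (c \<otimes> d) = inv c \<otimes> inv d"
  using C.inv_mult[of c d] subgroup.m_closed[OF C_subgroup] by (simp add: C_inv)

lemma mult_inv_cancel:
  "x \<in> carrier E \<Longrightarrow> y \<in> carrier E \<Longrightarrow> x \<otimes> y \<otimes> inv y = x"
  "x \<in> carrier E \<Longrightarrow> y \<in> carrier E \<Longrightarrow> x \<otimes> inv y \<otimes> y = x"
  by (simp_all add: G.m_assoc)

section \<open>Identities for the cocycle and the defect of a section\<close>

lemma cocycle_closed:
  "q \<in> carrier Q \<Longrightarrow> q' \<in> carrier Q \<Longrightarrow> cocycle q q' \<in> kernel E Q p"
  by (simp add: cocycle_def kernel_def section_closed proj_section)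

lemma defect_closed: "e \<in> carrier E \<Longrightarrow> defect e \<in> kernel E Q p"
  by (simp add: defect_def kernel_def section_closed proj_section)

lemma defect_kernel: "c \<in> kernel E Q p \<Longrightarrow> defect c = c"
  by (simp add: defect_def kernel_def section_one)

lemma cocycle_one:
  assumes "q \<in> carrier Q"
  shows "cocycle \<one>\<^bsub>Q\<^esub> q = \<one>" "cocycle q \<one>\<^bsub>Q\<^esub> = \<one>"
  using assms by (simp_all add: cocycle_def section_one section_closed)

lemma section_mult:
  assumes "q \<in> carrier Q" "q' \<in> carrier Q"
  shows "s q \<otimes> s q' = cocycle q q' \<otimes> s (q \<otimes>\<^bsub>Q\<^esub> q')"
  using assms by (simp add: cocycle_def section_closed G.m_assoc)

text \<open>This is associativity in \<open>E\<close>: multiplied by \<open>?t\<close>, both sides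
  become the product of \<open>s a\<close>, \<open>s b\<close> and \<open>s c\<close>. Centrality is
  what moves \<open>cocycle b c\<close> past \<open>s a\<close>.\<close>

lemma cocycle_identity:
  assumes "a \<in> carrier Q" "b \<in> carrier Q" "c \<in> carrier Q"
  shows "cocycle a b \<otimes> cocycle (a \<otimes>\<^bsub>Q\<^esub> b) c = cocycle b c \<otimes> cocycle a (b \<otimes>\<^bsub>Q\<^esub> c)"
proof -
  note cl = assms section_closed cocycle_closed[THEN C_carrier]
  let ?t = "s (a \<otimes>\<^bsub>Q\<^esub> b \<otimes>\<^bsub>Q\<^esub> c)"
  have "cocycle a b \<otimes> cocycle (a \<otimes>\<^bsub>Q\<^esub> b) c \<otimes> ?t = cocycle a b \<otimes> (s (a \<otimes>\<^bsub>Q\<^esub> b) \<otimes> s c)"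
    using cl by (simp add: G.m_assoc section_mult[of "a \<otimes>\<^bsub>Q\<^esub> b" c])
  also have "\<dots> = s a \<otimes> s b \<otimes> s c"
    using cl by (simp add: G.m_assoc section_mult[of a b])
  also have "\<dots> = s a \<otimes> (cocycle b c \<otimes> s (b \<otimes>\<^bsub>Q\<^esub> c))"
    using cl by (simp add: G.m_assoc section_mult[of b c])
  also have "\<dots> = s a \<otimes> cocycle b c \<otimes> s (b \<otimes>\<^bsub>Q\<^esub> c)"
    using cl by (simp add: G.m_assoc)
  also have "\<dots> = cocycle b c \<otimes> s a \<otimes> s (b \<otimes>\<^bsub>Q\<^esub> c)"
    using cl by (simp add: central[OF cocycle_closed])
  also have "\<dots> = cocycle b c \<otimes> (s a \<otimes> s (b \<otimes>\<^bsub>Q\<^esub> c))"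
    using cl by (simp add: G.m_assoc)
  also have "\<dots> = cocycle b c \<otimes> cocycle a (b \<otimes>\<^bsub>Q\<^esub> c) \<otimes> ?t"
    using cl by (simp add: section_mult[of a "b \<otimes>\<^bsub>Q\<^esub> c"] G.m_assoc H.m_assoc)
  finally show ?thesis using cl by simp
qed

text \<open>The pullback of the cocycle to \<open>E\<close> is a coboundary, namely that of
  \<open>defect\<close> up to sign. Each element is split as
  \<open>defect x \<otimes> s (p x)\<close> and the central factors are collected.\<close>

lemma cocycle_proj:
  assumes "e \<in> carrier E" "e' \<in> carrier E"
  shows "cocycle (p e) (p e') = defect (e \<otimes> e') \<otimes> inv (defect e) \<otimes> inv (defect e')"
proof -
  note cl = assms section_closed defect_closed[THEN C_carrier] cocycle_closed[THEN C_carrier]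
  have split: "defect x \<otimes> s (p x) = x" if "x \<in> carrier E" for x
  proof -
    have "s (p x) \<otimes> defect x = x"
      using that by (simp add: defect_def section_closed flip: G.m_assoc)
    then show ?thesis using central[OF defect_closed[OF that], of "s (p x)"] that
      by (simp add: section_closed)
  qed
  have comm: "s (p e) \<otimes> defect e' = defect e' \<otimes> s (p e)"
    using cl central[OF defect_closed[OF assms(2)], of "s (p e)"] by simp
  have "defect (e \<otimes> e') \<otimes> s (p e \<otimes>\<^bsub>Q\<^esub> p e') = e \<otimes> e'"
    using split[of "e \<otimes> e'"] assms by simp
  also have "\<dots> = (defect e \<otimes> s (p e)) \<otimes> (defect e' \<otimes> s (p e'))"
    using split assms by simp
  also have "\<dots> = defect e \<otimes> (s (p e) \<otimes> defect e') \<otimes> s (p e')"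
    using cl by (simp add: G.m_assoc)
  also have "\<dots> = defect e \<otimes> defect e' \<otimes> (s (p e) \<otimes> s (p e'))"
    unfolding comm using cl by (simp add: G.m_assoc)
  also have "\<dots> = defect e \<otimes> defect e' \<otimes> cocycle (p e) (p e') \<otimes> s (p e \<otimes>\<^bsub>Q\<^esub> p e')"
    using cl by (simp add: section_mult G.m_assoc)
  finally have "defect (e \<otimes> e') = defect e \<otimes> defect e' \<otimes> cocycle (p e) (p e')"
    using cl by simp
  also have "\<dots> = cocycle (p e) (p e') \<otimes> defect e' \<otimes> defect e"
    using assms by (simp add: C.m_ac defect_closed cocycle_closed)
  finally show ?thesis
    using cl by (simp add: mult_inv_cancel)
qed

lemma cocycle_cells:
  "(\<lambda>qs. cocycle (qs ! 0) (qs ! 1)) ` bar_cells Q 2 \<subseteq> kernel E Q p"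
  by (auto simp: bar_cells_2 intro!: cocycle_closed)

lemma defect_cells: "(\<lambda>es. defect (es ! 0)) ` bar_cells E 1 \<subseteq> kernel E Q p"
  by (auto simp: bar_cells_def length_Suc_conv intro!: defect_closed)

section \<open>The transgression on boundaries and on projected chains\<close>

lemmas transgression_simps =
  C.frag_prod_zero[OF cocycle_cells, folded transgression_def]
  C.frag_prod_add[OF cocycle_cells, folded transgression_def]
  C.frag_prod_diff[OF cocycle_cells, folded transgression_def]
  C.frag_prod_minus[OF cocycle_cells, folded transgression_def]

lemmas transgression_closed = C.frag_prod_closed[OF cocycle_cells, folded transgression_def]

lemmas defect_chain_simps =
  C.frag_prod_zero[OF defect_cells, folded defect_chain_def]
  C.frag_prod_add[OF defect_cells, folded defect_chain_def]
  C.frag_prod_diff[OF defect_cells, folded defect_chain_def]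
  C.frag_prod_minus[OF defect_cells, folded defect_chain_def]

lemmas defect_chain_closed = C.frag_prod_closed[OF defect_cells, folded defect_chain_def]

lemma transgression_symbol:
  assumes "q \<in> carrier Q" "q' \<in> carrier Q"
  shows "transgression (bar_symbol Q [q, q']) = cocycle q q'"
proof (cases "q = \<one>\<^bsub>Q\<^esub> \<or> q' = \<one>\<^bsub>Q\<^esub>")
  case True
  then show ?thesis using assms cocycle_one by (auto simp: bar_symbol_def transgression_simps)
next
  case False
  then have "[q, q'] \<in> bar_cells Q 2" using assms by (simp add: bar_cells_2)
  from C.frag_prod_of[OF cocycle_cells this] show ?thesis using False
    by (auto simp: bar_symbol_def transgression_def)
qed

lemma defect_chain_symbol:
  assumes "e \<in> carrier E"
  shows "defect_chain (bar_symbol E [e]) = defect e"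
proof (cases "e = \<one>")
  case True
  then show ?thesis using defect_kernel[of \<one>]
    by (simp add: bar_symbol_def defect_chain_simps kernel_def)
next
  case False
  then have "[e] \<in> bar_cells E 1" using assms by (simp add: bar_cells_def)
  from C.frag_prod_of[OF defect_cells this] show ?thesis using False
    by (auto simp: bar_symbol_def defect_chain_def)
qed

lemma keys_symbol2:
  "a \<in> carrier Q \<Longrightarrow> b \<in> carrier Q \<Longrightarrow> Poly_Mapping.keys (bar_symbol Q [a, b]) \<subseteq> bar_cells Q 2"
  "c \<in> carrier E \<Longrightarrow> d \<in> carrier E \<Longrightarrow> Poly_Mapping.keys (bar_symbol E [c, d]) \<subseteq> bar_cells E 2"
  "c \<in> carrier E \<Longrightarrow> Poly_Mapping.keys (bar_symbol E [c]) \<subseteq> bar_cells E 1"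
  by (simp_all add: keys_bar_symbol)

text \<open>On a generator the value is the quotient of the two sides of
  \<open>cocycle_identity\<close>.\<close>

lemma transgression_boundary:
  assumes "Poly_Mapping.keys c \<subseteq> bar_cells Q 3"
  shows "transgression (bar_boundary Q c) = \<one>"
  using assms
proof (induction rule: free_Abelian_group_induct[consumes 1, case_names zero diff one])
  case zero
  then show ?case by (simp add: bar_boundary_zero transgression_simps)
next
  case (diff x y)
  then show ?case
    by (simp add: bar_boundary_diff transgression_simps H.keys_bar_boundary3 C_inv)
next
  case (one qs)
  then obtain a b c where abc: "qs = [a, b, c]" "a \<in> carrier Q" "b \<in> carrier Q" "c \<in> carrier Q"
    by (auto simp: bar_cells_3)
  let ?x = "cocycle b c \<otimes> inv cocycle (a \<otimes>\<^bsub>Q\<^esub> b) c \<otimes> cocycle a (b \<otimes>\<^bsub>Q\<^esub> c) \<otimes> inv cocycle a b"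
  note cl = abc(2-4) cocycle_closed
  have "transgression (bar_boundary Q (frag_of qs)) = ?x"
    unfolding abc(1) H.bar_boundary_of3
    using cl by (simp add: transgression_simps transgression_symbol keys_symbol2 keys_add_subset
        keys_diff_subset C_inv)
  also have "\<dots> = cocycle b c \<otimes> cocycle a (b \<otimes>\<^bsub>Q\<^esub> c) \<otimes> inv cocycle (a \<otimes>\<^bsub>Q\<^esub> b) c \<otimes> inv cocycle a b"
    using cl by (simp add: C.m_ac C_inv_closed)
  also have "\<dots> = \<one>"
    using cl by (simp add: mult_inv_cancel C_carrier flip: cocycle_identity)
  finally show ?case .
qed

text \<open>The linear extension of \<open>cocycle_proj\<close>. It serves twice: projected cycles
  of \<open>E\<close> are killed, and a chain of \<open>E\<close> with known boundary has a known
  transgression.\<close>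

lemma transgression_proj:
  assumes "Poly_Mapping.keys z \<subseteq> bar_cells E 2"
  shows "transgression (bar_map Q p z) = inv (defect_chain (bar_boundary E z))"
  using assms
proof (induction rule: free_Abelian_group_induct[consumes 1, case_names zero diff one])
  case zero
  then show ?case by (simp add: bar_boundary_zero bar_map_zero transgression_simps defect_chain_simps)
next
  case (diff x y)
  have k: "Poly_Mapping.keys (bar_map Q p u) \<subseteq> bar_cells Q 2"
    "Poly_Mapping.keys (bar_boundary E u) \<subseteq> bar_cells E 1"
    if "Poly_Mapping.keys u \<subseteq> bar_cells E 2" for u
    using that keys_bar_map[of p E Q u] G.keys_bar_boundary2 by auto
  show ?case
    using diff k defect_chain_closed[OF k(2)]
    by (simp add: bar_boundary_diff bar_map_diff transgression_simps defect_chain_simps C_inv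
        C_inv_mult C_inv_closed)
next
  case (one qs)
  then obtain a b where ab: "qs = [a, b]" "a \<in> carrier E" "b \<in> carrier E"
    by (auto simp: bar_cells_2)
  have "inv (defect b \<otimes> inv defect (a \<otimes> b) \<otimes> defect a) = defect (a \<otimes> b) \<otimes> inv (defect a) \<otimes> inv (defect b)"
    using ab defect_closed C_inv_closed
    by (simp add: C_carrier C_inv_mult C.m_ac)
  then show ?case
    unfolding bar_symbol_of_cell[OF one, symmetric]
    using ab by (simp add: bar_map_symbol transgression_symbol cocycle_proj G.bar_boundary_symbol2
        defect_chain_simps defect_chain_symbol keys_symbol2 keys_diff_subset C_inv defect_closed
        del: One_nat_def)
qed

lemma transgression_proj_cycle:
  assumes "Poly_Mapping.keys z \<subseteq> bar_cells E 2" "bar_boundary E z = 0"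
  shows "transgression (bar_map Q p z) = \<one>"
  using transgression_proj[OF assms(1)] assms(2) by (simp add: defect_chain_simps)

section \<open>Exactness at the cycles of Q, and prescribed values\<close>

definition fibre_boundaries where
  "fibre_boundaries = {bar_boundary E w | w. Poly_Mapping.keys w \<subseteq> bar_cells E 2 \<and> bar_map Q p w = 0}"

lemma fibre_boundaries_zero: "0 \<in> fibre_boundaries"
  unfolding fibre_boundaries_def
  by (rule CollectI, rule exI[of _ 0]) (simp add: bar_boundary_zero bar_map_zero)

lemma fibre_boundaries_diff:
  assumes "u \<in> fibre_boundaries" "v \<in> fibre_boundaries"
  shows "u - v \<in> fibre_boundaries"
proof -
  from assms obtain x y where
    "Poly_Mapping.keys x \<subseteq> bar_cells E 2" "bar_map Q p x = 0" "u = bar_boundary E x"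
    "Poly_Mapping.keys y \<subseteq> bar_cells E 2" "bar_map Q p y = 0" "v = bar_boundary E y"
    unfolding fibre_boundaries_def by auto
  then show ?thesis unfolding fibre_boundaries_def
    by (intro CollectI exI[of _ "x - y"]) (simp add: bar_boundary_diff bar_map_diff keys_diff_subset)
qed

text \<open>The 2-chain \<open>[c, d]\<close> projects to a degenerate symbol, so it can be added to
  a lift without changing the projection.\<close>

lemma fibre_boundaries_symbol:
  assumes "c \<in> kernel E Q p" "d \<in> kernel E Q p"
  shows "bar_symbol E [d] - bar_symbol E [c \<otimes> d] + bar_symbol E [c] \<in> fibre_boundaries"
  unfolding fibre_boundaries_def
  using assms
  by (intro CollectI exI[of _ "bar_symbol E [c, d]"])
    (simp add: G.bar_boundary_symbol2 C_carrier keys_symbol2 bar_map_symbol, simp add: kernel_def bar_symbol_def)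

text \<open>This is \<open>H\<^sub>1(C) = C\<close> for the abelian group \<open>C\<close>.\<close>
lemma cocycle_chain_boundary:
  assumes "Poly_Mapping.keys z \<subseteq> bar_cells Q 2"
  shows "frag_extend (\<lambda>qs. bar_symbol E [cocycle (qs ! 0) (qs ! 1)]) z
    - bar_symbol E [transgression z] \<in> fibre_boundaries"
  using assms
proof (induction rule: free_Abelian_group_induct[consumes 1, case_names zero diff one])
  case zero
  then show ?case by (simp add: transgression_simps bar_symbol_def fibre_boundaries_zero)
next
  case (diff x y)
  let ?t = transgression and ?b = "\<lambda>c. bar_symbol E [c]"
  let ?a = "frag_extend (\<lambda>qs. bar_symbol E [cocycle (qs ! 0) (qs ! 1)])"
  have t: "?t x \<in> kernel E Q p" "?t y \<in> kernel E Q p" using diff transgression_closed by auto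
  then have m: "?t (x - y) \<in> kernel E Q p" "?t (x - y) \<otimes> ?t y = ?t x"
    using diff by (auto simp: transgression_simps C_inv C_carrier G.m_assoc
        intro: subgroup.m_closed[OF C_subgroup] subgroup.m_inv_closed[OF C_subgroup])
  \<comment> \<open>The last bracket is the boundary of the symbol \<open>[c, d]\<close> with
    \<open>c = ?t (x - y)\<close> and \<open>d = ?t y\<close>, whose product is
    \<open>?t x\<close>.\<close>
  have eq: "?a (x - y) - ?b (?t (x - y)) = ?a x - ?b (?t x) - (?a y - ?b (?t y))
     - (?b (?t y) - ?b (?t x) + ?b (?t (x - y)))"
    by (simp add: frag_extend_diff)
  have "?b (?t y) - ?b (?t x) + ?b (?t (x - y)) \<in> fibre_boundaries"
    using fibre_boundaries_symbol[OF m(1) t(2)] m(2) by simp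
  from fibre_boundaries_diff[OF fibre_boundaries_diff[OF diff(3,4)] this]
  show ?case unfolding eq .
next
  case (one qs)
  then obtain a b where ab: "qs = [a, b]" "a \<in> carrier Q" "b \<in> carrier Q"
    by (auto simp: bar_cells_2)
  then have "transgression (frag_of qs) = cocycle a b"
    using transgression_symbol[of a b] bar_symbol_of_cell[OF one] by simp
  then show ?case using ab fibre_boundaries_zero by simp
qed

text \<open>The correction term is chosen so that the boundary of the lift of \<open>z\<close> is the lift of
  \<open>\<partial>z\<close> up to entries in \<open>C\<close>; it projects to degenerate symbols.\<close>
definition lift where
  "lift = frag_extend (\<lambda>qs. bar_symbol E [s (qs ! 0), s (qs ! 1)]
     - bar_symbol E [cocycle (qs ! 0) (qs ! 1), s (qs ! 0 \<otimes>\<^bsub>Q\<^esub> qs ! 1)])"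

text \<open>On \<open>[a, b]\<close> the two parts of the lift share the boundary term for
  \<open>s a \<otimes> s b\<close>, by \<open>section_mult\<close>. It cancels, leaving the image of
  the boundary under \<open>s\<close> minus the symbol of the cocycle value.\<close>

lemma lift_props:
  assumes "Poly_Mapping.keys z \<subseteq> bar_cells Q 2"
  shows "Poly_Mapping.keys (lift z) \<subseteq> bar_cells E 2 \<and> bar_map Q p (lift z) = z \<and>
    bar_boundary E (lift z) = bar_map E s (bar_boundary Q z)
      - frag_extend (\<lambda>qs. bar_symbol E [cocycle (qs ! 0) (qs ! 1)]) z"
  using assms
proof (induction rule: free_Abelian_group_induct[consumes 1, case_names zero diff one])
  case zero
  then show ?case by (simp add: lift_def bar_boundary_zero bar_map_zero)
next
  case (diff x y)
  have "lift (x - y) = lift x - lift y" by (simp add: lift_def frag_extend_diff)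
  with diff show ?case
    by (simp add: bar_boundary_diff bar_map_diff frag_extend_diff keys_diff_subset)
next
  case (one qs)
  then obtain a b where ab: "qs = [a, b]" "a \<in> carrier Q" "b \<in> carrier Q"
    by (auto simp: bar_cells_2)
  note cl = ab section_closed cocycle_closed[THEN C_carrier]
  have l: "lift (frag_of qs) = bar_symbol E [s a, s b] - bar_symbol E [cocycle a b, s (a \<otimes>\<^bsub>Q\<^esub> b)]"
    by (simp add: lift_def ab)
  have "p (cocycle a b) = \<one>\<^bsub>Q\<^esub>" using cocycle_closed ab by (simp add: kernel_def)
  then have "bar_map Q p (lift (frag_of qs)) = bar_symbol Q [a, b]"
    unfolding l using ab
    by (simp add: bar_map_diff bar_map_symbol proj_section) (simp add: bar_symbol_def)
  moreover have "bar_boundary E (lift (frag_of qs)) = bar_map E s (bar_boundary Q (bar_symbol Q [a, b]))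
      - bar_symbol E [cocycle a b]"
    unfolding l using cl
    by (simp add: bar_boundary_diff G.bar_boundary_symbol2 H.bar_boundary_symbol2 bar_map_add
        bar_map_diff bar_map_symbol section_one section_mult)
  moreover have "Poly_Mapping.keys (lift (frag_of qs)) \<subseteq> bar_cells E 2"
    unfolding l using cl by (intro keys_diff_subset keys_symbol2) auto
  ultimately show ?case using ab bar_symbol_of_cell[OF one] by simp
qed

text \<open>For a cycle \<open>z\<close> the boundary of \<open>lift z\<close> is
  \<open>- ?a\<close>. Since the symbol of \<open>transgression z = \<one>\<close> is 0,
  \<open>?a\<close> itself is a fibre boundary, and the chain \<open>w\<close> it bounds corrects
  the lift to a cycle over \<open>z\<close>.\<close>

lemma transgression_exact:
  assumes "Poly_Mapping.keys z \<subseteq> bar_cells Q 2" "bar_boundary Q z = 0" "transgression z = \<one>"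
  obtains z' where "Poly_Mapping.keys z' \<subseteq> bar_cells E 2" "bar_boundary E z' = 0" "bar_map Q p z' = z"
proof -
  let ?a = "frag_extend (\<lambda>qs. bar_symbol E [cocycle (qs ! 0) (qs ! 1)]) z"
  have "?a \<in> fibre_boundaries"
    using cocycle_chain_boundary[OF assms(1)] assms(3) by (simp add: bar_symbol_def)
  then obtain w where "Poly_Mapping.keys w \<subseteq> bar_cells E 2" "bar_map Q p w = 0" "?a = bar_boundary E w"
    unfolding fibre_boundaries_def by blast
  then show ?thesis using that[of "lift z + w"] lift_props[OF assms(1)] assms(2)
    by (simp add: bar_map_add bar_boundary_add bar_map_zero keys_add_subset)
qed

text \<open>The projection of \<open>w\<close> is a cycle because \<open>p c\<close> is the
  identity, whose symbol is 0. Its transgression is the inverse of \<open>defect c = c\<close>,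
  which explains the minus sign.\<close>

lemma transgression_surj:
  assumes "c \<in> kernel E Q p" "Poly_Mapping.keys w \<subseteq> bar_cells E 2" "bar_boundary E w = bar_symbol E [c]"
  shows "Poly_Mapping.keys (- bar_map Q p w) \<subseteq> bar_cells Q 2" "bar_boundary Q (- bar_map Q p w) = 0"
    "transgression (- bar_map Q p w) = c"
proof -
  have k: "Poly_Mapping.keys (bar_map Q p w) \<subseteq> bar_cells Q 2"
    using keys_bar_map[of p E Q w] assms(2) by auto
  then show "Poly_Mapping.keys (- bar_map Q p w) \<subseteq> bar_cells Q 2" by simp
  have "p c = \<one>\<^bsub>Q\<^esub>" using assms(1) by (simp add: kernel_def)
  then show "bar_boundary Q (- bar_map Q p w) = 0"
    by (simp add: bar_boundary_minus bar_boundary_bar_map assms(2,3) bar_map_symbol)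
      (simp add: bar_symbol_def)
  have "transgression (bar_map Q p w) = inv c"
    using transgression_proj[OF assms(2)] assms
    by (simp add: defect_chain_symbol defect_kernel C_carrier)
  then show "transgression (- bar_map Q p w) = c"
    using k assms(1) subgroup.m_inv_closed[OF C_subgroup]
    by (simp add: transgression_simps C_inv C_carrier)
qed

end

section \<open>The filtration of the group ring\<close>

locale N_series_group = group G for G (structure) +
  fixes H :: "nat \<Rightarrow> 'a set" and n :: nat
  assumes series: "N_series G H" and n_pos: "1 \<le> n"
begin

abbreviation "ZG \<equiv> free_Abelian_group (carrier G)"
abbreviation gr_mult (infixl \<open>\<bullet>\<close> 70) where "u \<bullet> v \<equiv> u \<otimes>\<^bsub>group_ring G\<^esub> v"
abbreviation "E \<equiv> E_grp G H n"
abbreviation "Q \<equiv> Q_grp G H n"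
abbreviation "p \<equiv> proj_EQ G H n"
abbreviation cls where "cls g \<equiv> H (Suc n) #> g"

section \<open>The series and the ideals it defines\<close>

lemma H_one: "H (Suc 0) = carrier G"
  and H_subgroup: "1 \<le> a \<Longrightarrow> subgroup (H a) G"
  and H_Suc: "1 \<le> a \<Longrightarrow> H (Suc a) \<subseteq> H a"
  and H_comm: "1 \<le> a \<Longrightarrow> 1 \<le> b \<Longrightarrow> commutator_subgroup G (H a) (H b) \<subseteq> H (a + b)"
  using series by (auto simp: N_series_def)

lemma H_carrier: "1 \<le> a \<Longrightarrow> h \<in> H a \<Longrightarrow> h \<in> carrier G"
  using H_subgroup subgroup.mem_carrier by metis

lemma H_normal: "1 \<le> a \<Longrightarrow> H a \<lhd> G"
  using N_series_normal[OF is_group series] .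

lemma H_mono:
  assumes "1 \<le> a" "a \<le> b"
  shows "H b \<subseteq> H a"
  using assms(2)
proof (induction b rule: dec_induct)
  case (step b)
  then show ?case using H_Suc[of b] assms(1) by auto
qed simp

lemma add_monoid_group_ring: "add_monoid (group_ring G) = ZG"
  by (simp add: group_ring_def free_Abelian_group_def)

lemma gr_diff_eq: "x \<in> carrier G \<Longrightarrow> gr_diff G x = frag_of x - frag_of \<one>"
  by (simp only: gr_diff_def a_minus_def a_inv_def add_monoid_group_ring) (simp add: group_ring_def)

lemma keys_gr_diff: "x \<in> carrier G \<Longrightarrow> Poly_Mapping.keys (gr_diff G x) \<subseteq> carrier G"
  by (simp add: gr_diff_eq keys_diff_subset)

lemma gr_mult_eq: "u \<bullet> v = frag_extend (\<lambda>g. frag_extend (\<lambda>h. frag_of (g \<otimes> h)) v) u"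
  by (simp add: group_ring_def)

lemma keys_gr_mult:
  assumes "Poly_Mapping.keys u \<subseteq> carrier G" "Poly_Mapping.keys v \<subseteq> carrier G"
  shows "Poly_Mapping.keys (u \<bullet> v) \<subseteq> carrier G"
  unfolding gr_mult_eq using assms by (intro keys_frag_extend_subset) auto

text \<open>The factor \<one> stays in \<open>\<one> \<otimes> h\<close> because \<open>v\<close>
  may have support outside the carrier.\<close>

lemma gr_diff_mult:
  assumes "x \<in> carrier G"
  shows "gr_diff G x \<bullet> v = frag_extend (\<lambda>h. frag_of (x \<otimes> h)) v - frag_extend (\<lambda>h. frag_of (\<one> \<otimes> h)) v"
  using assms by (simp add: gr_diff_eq gr_mult_eq frag_extend_diff)

lemma gr_diff_mult_one: "x \<in> carrier G \<Longrightarrow> gr_diff G x \<bullet> \<one>\<^bsub>group_ring G\<^esub> = gr_diff G x"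
  by (simp add: gr_diff_mult) (simp add: group_ring_def gr_diff_eq)

abbreviation prod_diff where
  "prod_diff ps \<equiv> foldr (\<bullet>) (map (\<lambda>(a, x). gr_diff G x) ps) \<one>\<^bsub>group_ring G\<^esub>"

lemma keys_prod_diff:
  assumes "\<forall>(a, x)\<in>set ps. 1 \<le> a \<and> x \<in> H a"
  shows "Poly_Mapping.keys (prod_diff ps) \<subseteq> carrier G"
  using assms
proof (induction ps)
  case Nil
  then show ?case by (simp add: group_ring_def)
next
  case (Cons q ps)
  obtain a x where q: "q = (a, x)" by fastforce
  then show ?case using Cons H_carrier by (auto simp del: One_nat_def intro!: keys_gr_mult keys_gr_diff del: subsetI)
qed

lemma A_filt_eq:
  "A_filt G H m = generate ZG {prod_diff ps | ps.
     (\<forall>(a, x)\<in>set ps. 1 \<le> a \<and> x \<in> H a) \<and> m \<le> sum_list (map fst ps)}"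
  by (simp only: A_filt_def add_monoid_group_ring)

lemma A_filt_subgroup: "subgroup (A_filt G H m) ZG"
  unfolding A_filt_eq
  by (rule group.generate_is_subgroup, simp, rule subsetI, elim CollectE exE conjE)
    (simp only: carrier_free_Abelian_group_iff keys_prod_diff)

lemma A_filt_add: "u \<in> A_filt G H m \<Longrightarrow> v \<in> A_filt G H m \<Longrightarrow> u + v \<in> A_filt G H m"
  using subgroup.m_closed[OF A_filt_subgroup] by simp

lemma A_filt_antimono:
  assumes "m \<le> m'"
  shows "A_filt G H m' \<subseteq> A_filt G H m"
  unfolding A_filt_eq
  by (rule group.mono_generate[OF group_free_Abelian_group]) (use assms in force)

lemma gr_diff_in_A_filt:
  assumes "1 \<le> a" "x \<in> H a" "m \<le> a"
  shows "gr_diff G x \<in> A_filt G H m"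
  unfolding A_filt_eq using assms gr_diff_mult_one[OF H_carrier[OF assms(1,2)]]
  by (intro generate.incl CollectI exI[of _ "[(a, x)]"]) auto

lemma gr_diff_mult_in_A_filt:
  assumes "1 \<le> a" "x \<in> H a" "1 \<le> b" "y \<in> H b" "m \<le> a + b"
  shows "gr_diff G x \<bullet> gr_diff G y \<in> A_filt G H m"
  unfolding A_filt_eq using assms gr_diff_mult_one[OF H_carrier[OF assms(3,4)]]
  by (intro generate.incl CollectI exI[of _ "[(a, x), (b, y)]"]) auto

lemma gr_diff_of_mult:
  assumes "x \<in> carrier G" "y \<in> carrier G"
  shows "gr_diff G (x \<otimes> y) = gr_diff G x \<bullet> gr_diff G y + gr_diff G x + gr_diff G y"
  using assms by (simp add: gr_diff_mult) (simp add: gr_diff_eq frag_extend_diff)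

section \<open>The quotients E and Q and the central kernel\<close>

lemma E_carrier: "carrier E = cls ` carrier G"
  and Q_carrier: "carrier Q = (\<lambda>g. H n #> g) ` carrier G"
  by (auto simp: E_grp_def Q_grp_def carrier_FactGroup)

lemma E_group: "group E" and Q_group: "group Q"
  using H_normal n_pos unfolding E_grp_def Q_grp_def by (auto intro!: normal.factorgroup_is_group)

lemma E_mult: "x \<in> carrier G \<Longrightarrow> y \<in> carrier G \<Longrightarrow> cls x \<otimes>\<^bsub>E\<^esub> cls y = cls (x \<otimes> y)"
  using normal.rcos_sum[OF H_normal[of "Suc n"]] by (simp add: E_grp_def)

lemma Q_mult:
  "x \<in> carrier G \<Longrightarrow> y \<in> carrier G \<Longrightarrow> (H n #> x) \<otimes>\<^bsub>Q\<^esub> (H n #> y) = H n #> (x \<otimes> y)"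
  using normal.rcos_sum[OF H_normal[OF n_pos]] by (simp add: Q_grp_def)

lemma E_one: "\<one>\<^bsub>E\<^esub> = H (Suc n)" and Q_one: "\<one>\<^bsub>Q\<^esub> = H n"
  by (simp_all add: E_grp_def Q_grp_def)

lemma cls_one: "cls \<one> = \<one>\<^bsub>E\<^esub>"
  using coset_join2[OF one_closed H_subgroup[of "Suc n"]] subgroup.one_closed[OF H_subgroup[of "Suc n"]]
  by (simp add: E_one)

lemma p_cls: "g \<in> carrier G \<Longrightarrow> p (cls g) = H n #> g"
  using proj_EQ_coset[OF is_group series n_pos] .

lemma p_hom: "group_hom E Q p"
  unfolding group_hom_def group_hom_axioms_def
  using E_group Q_group by (auto intro!: homI simp: E_carrier Q_carrier E_mult Q_mult p_cls)

lemma kernel_p: "kernel E Q p = cls ` H n"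
  using H_carrier[OF n_pos] coset_join1[OF _ _ H_subgroup[OF n_pos]]
    coset_join2[OF _ H_subgroup[OF n_pos]]
  by (auto simp: kernel_def E_carrier p_cls Q_one)

lemma C_grp_eq: "C_grp G H n = E\<lparr>carrier := kernel E Q p\<rparr>"
proof -
  have "set_mult (G\<lparr>carrier := H n\<rparr>) = set_mult G"
    by (simp add: set_mult_def fun_eq_iff)
  then show ?thesis
    unfolding kernel_p
    by (auto simp: C_grp_def E_grp_def FactGroup_def RCOSETS_def r_coset_def)
qed

text \<open>The commutator of an element of \<open>H n\<close> with one of \<open>H 1\<close>, the
  whole group, lies in \<open>H (Suc n)\<close> and so is trivial in \<open>E\<close>.\<close>

lemma kernel_p_central:
  assumes "c \<in> kernel E Q p" "e \<in> carrier E"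
  shows "c \<otimes>\<^bsub>E\<^esub> e = e \<otimes>\<^bsub>E\<^esub> c"
proof -
  obtain h g where hg: "c = cls h" "h \<in> H n" "e = cls g" "g \<in> carrier G"
    using assms by (auto simp: kernel_p E_carrier)
  have h: "h \<in> carrier G" using H_carrier n_pos hg by auto
  have inv_cancel: "inv g \<otimes> (g \<otimes> h) = h" "inv h \<otimes> h = \<one>"
    using h hg(4) by (simp_all flip: m_assoc)
  let ?k = "h \<otimes> g \<otimes> inv h \<otimes> inv g"
  have "?k \<in> commutator_subgroup G (H n) (H 1)"
    unfolding commutator_subgroup_def using hg by (intro generate.incl) (auto simp: H_one)
  then have "?k \<in> H (Suc n)" using H_comm[OF n_pos, of 1] by auto
  moreover have "h \<otimes> g = ?k \<otimes> (g \<otimes> h)"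
    using h hg(4) by (simp add: m_assoc inv_cancel)
  ultimately have "h \<otimes> g \<in> cls (g \<otimes> h)" unfolding r_coset_def by blast
  then have "cls (g \<otimes> h) = cls (h \<otimes> g)"
    using h hg(4) H_subgroup[of "Suc n"] by (intro repr_independence) auto
  then show ?thesis using hg h by (simp add: E_mult)
qed

section \<open>From the filtration to the first homology of E\<close>

text \<open>Modulo boundaries \<open>[x|y]\<close>, the map sending \<open>g\<close> to the symbol of its class in \<open>E\<close> carries \<open>(x - 1)v\<close>
  to the augmentation of \<open>v\<close> times the symbol of \<open>x\<close>, so it kills all products of at least two
  factors.\<close>
definition gr_symbol where
  "gr_symbol = frag_extend (\<lambda>g. bar_symbol E [cls g])"

definition boundaries where
  "boundaries = bar_boundary E ` {w. Poly_Mapping.keys w \<subseteq> bar_cells E 2}"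

lemma boundaries_diff: "u \<in> boundaries \<Longrightarrow> v \<in> boundaries \<Longrightarrow> u - v \<in> boundaries"
  unfolding boundaries_def by (auto simp: keys_diff_subset simp flip: bar_boundary_diff)

lemma boundaries_zero: "0 \<in> boundaries"
  unfolding boundaries_def using bar_boundary_zero by (force intro!: image_eqI[of _ _ 0])

text \<open>For a single group element \<open>g\<close> the difference is exactly the boundary of
  \<open>[cls x, cls g]\<close>; the general case is additive in \<open>v\<close>.\<close>

lemma gr_symbol_mult:
  assumes "x \<in> carrier G" "Poly_Mapping.keys v \<subseteq> carrier G"
  shows "frag_extend (\<lambda>_. bar_symbol E [cls x]) v - gr_symbol (gr_diff G x \<bullet> v) \<in> boundaries"
  using assms(2)
proof (induction rule: free_Abelian_group_induct[consumes 1, case_names zero diff one])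
  case zero
  then show ?case using boundaries_zero by (simp add: gr_diff_mult assms gr_symbol_def)
next
  case (diff u v)
  let ?a = "frag_extend (\<lambda>_. bar_symbol E [cls x])" and ?d = "\<lambda>v. gr_symbol (gr_diff G x \<bullet> v)"
  have "?a (u - v) - ?d (u - v) = ?a u - ?d u - (?a v - ?d v)"
    by (simp add: gr_diff_mult assms gr_symbol_def frag_extend_diff)
  then show ?case using boundaries_diff[OF diff(3,4)] by simp
next
  case (one g)
  interpret E: group E by (rule E_group)
  have cl: "cls x \<in> carrier E" "cls g \<in> carrier E" using assms one by (auto simp: E_carrier)
  have eq: "frag_extend (\<lambda>_. bar_symbol E [cls x]) (frag_of g) - gr_symbol (gr_diff G x \<bullet> frag_of g)
    = bar_boundary E (bar_symbol E [cls x, cls g])"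
    using cl assms one
    by (simp add: gr_diff_mult gr_symbol_def frag_extend_diff E.bar_boundary_symbol2 E_mult)
  have "Poly_Mapping.keys (bar_symbol E [cls x, cls g]) \<subseteq> bar_cells E 2"
    using cl by (intro keys_bar_symbol) auto
  then show ?case unfolding eq boundaries_def by blast
qed

text \<open>Left translation preserves the augmentation, so the two terms of
  \<open>gr_diff_mult\<close> contribute equally and cancel.\<close>

lemma augmentation_gr_diff_mult:
  assumes "x \<in> carrier G"
  shows "frag_extend (\<lambda>_. c) (gr_diff G x \<bullet> v) = 0"
  using frag_extend_compose[of "\<lambda>_. c" "\<lambda>h. x \<otimes> h" v] frag_extend_compose[of "\<lambda>_. c" "\<lambda>h. \<one> \<otimes> h" v]
  by (simp add: gr_diff_mult assms frag_extend_diff comp_def)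

lemma gr_symbol_A_filt:
  assumes "u \<in> A_filt G H (Suc n)"
  shows "gr_symbol u \<in> boundaries"
proof -
  have gen: "gr_symbol (prod_diff ps) \<in> boundaries"
    if ps: "\<forall>(a, x)\<in>set ps. 1 \<le> a \<and> x \<in> H a" "Suc n \<le> sum_list (map fst ps)" for ps
  proof -
    \<comment> \<open>The empty product has weight 0, so the weight condition excludes it.\<close>
    obtain a x qs where p1: "ps = (a, x) # qs"
      using ps(2) by (cases ps) auto
    then have x: "1 \<le> a" "x \<in> H a" "x \<in> carrier G" using ps(1) H_carrier by auto
    show ?thesis
    proof (cases qs)
      case Nil
      \<comment> \<open>A single factor carries the whole weight, hence \<open>a\<close> is at least
        \<open>Suc n\<close> and \<open>x\<close> is trivial in \<open>E\<close>.\<close>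
      then have "x \<in> H (Suc n)" using H_mono[of "Suc n" a] x p1 ps(2) by auto
      then have "cls x = \<one>\<^bsub>E\<^esub>"
        using coset_join2[OF x(3) H_subgroup[of "Suc n"]] by (simp add: E_one)
      moreover have "prod_diff ps = gr_diff G x" using p1 Nil gr_diff_mult_one[OF x(3)] by simp
      ultimately show ?thesis
        using boundaries_zero x(3)
        by (simp add: gr_symbol_def gr_diff_eq frag_extend_diff cls_one)
    next
      case (Cons q rs)
      obtain b y where q: "q = (b, y)" by fastforce
      then have y: "y \<in> carrier G" using ps(1) p1 Cons H_carrier by auto
      have k: "Poly_Mapping.keys (prod_diff qs) \<subseteq> carrier G"
        using ps(1) p1 by (intro keys_prod_diff) auto
      \<comment> \<open>The remaining product starts with the factor \<open>gr_diff G y\<close>, so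
        its augmentation is 0.\<close>
      have "frag_extend (\<lambda>_. bar_symbol E [cls x]) (prod_diff qs) = 0"
        using Cons q augmentation_gr_diff_mult[OF y] by simp
      then have "0 - gr_symbol (prod_diff ps) \<in> boundaries"
        using gr_symbol_mult[OF x(3) k] p1 by simp
      from boundaries_diff[OF boundaries_zero this] show ?thesis by simp
    qed
  qed
  have k: "Poly_Mapping.keys (prod_diff ps) \<subseteq> carrier G"
    if "\<forall>(a, x)\<in>set ps. 1 \<le> a \<and> x \<in> H a" for ps
    using keys_prod_diff[OF that] .
  show ?thesis using assms unfolding A_filt_eq
  proof (induction rule: generate.induct)
    case one
    then show ?case using boundaries_zero by (simp add: gr_symbol_def)
  next
    case (incl u)
    then show ?case using gen by blast
  next
    case (inv u)
    then obtain ps where ps: "u = prod_diff ps" "\<forall>(a, x)\<in>set ps. 1 \<le> a \<and> x \<in> H a"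
      "Suc n \<le> sum_list (map fst ps)" by blast
    then have "0 - gr_symbol u \<in> boundaries" using boundaries_diff[OF boundaries_zero gen] by simp
    moreover have "inv\<^bsub>ZG\<^esub> u = - u" using k[OF ps(2)] ps(1) by simp
    ultimately show ?case by (simp add: gr_symbol_def frag_extend_minus)
  next
    case (eng u v)
    then have "gr_symbol u - (0 - gr_symbol v) \<in> boundaries"
      by (intro boundaries_diff boundaries_zero)
    then show ?case by (simp add: gr_symbol_def frag_extend_add)
  qed
qed

text \<open>The symbol of the identity is 0, so \<open>gr_symbol\<close> sends
  \<open>gr_diff G h\<close> to the symbol of \<open>cls h\<close> alone.\<close>

lemma symbol_boundary:
  assumes "h \<in> carrier G" "gr_diff G h \<in> A_filt G H (Suc n)"
  shows "bar_symbol E [cls h] \<in> boundaries"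
proof -
  have "bar_symbol E [\<one>\<^bsub>E\<^esub>] = 0" by (simp add: bar_symbol_def)
  then have "gr_symbol (gr_diff G h) = bar_symbol E [cls h]"
    using assms(1) by (simp add: gr_symbol_def gr_diff_eq frag_extend_diff cls_one)
  then show ?thesis using gr_symbol_A_filt[OF assms(2)] by simp
qed

end

section \<open>The cokernel\<close>

lemma (in comm_group) subgroup_imp_comm_group:
  "subgroup K G \<Longrightarrow> comm_group (G\<lparr>carrier := K\<rparr>)"
  by (intro group.group_comm_groupI subgroup_imp_group) (auto simp: subgroup.mem_carrier m_comm)

context N_series_group
begin

abbreviation "C \<equiv> C_grp G H n"
abbreviation "A \<equiv> A_gr G H n"
abbreviation A_cls where "A_cls u \<equiv> A_filt G H (Suc n) #>\<^bsub>ZG\<^esub> u"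

section \<open>The graded quotient and the homomorphism phi\<close>

lemma A_cls_eqI:
  assumes "Poly_Mapping.keys v \<subseteq> carrier G" "u - v \<in> A_filt G H (Suc n)"
  shows "A_cls u = A_cls v"
proof -
  interpret ZG: comm_group ZG by (rule abelian_free_Abelian_group)
  have "u = (u - v) \<otimes>\<^bsub>ZG\<^esub> v" by simp
  then have "u \<in> A_cls v" using assms(2) unfolding r_coset_def by blast
  then show ?thesis using ZG.repr_independence[OF _ _ A_filt_subgroup] assms(1) by simp
qed

lemma A_gr_eq: "A = (ZG\<lparr>carrier := A_filt G H n\<rparr>) Mod A_filt G H (Suc n)"
  by (simp only: A_gr_def add_monoid_group_ring)

lemma A_carrier: "carrier A = A_cls ` A_filt G H n"
  by (auto simp: A_gr_eq carrier_FactGroup r_coset_def)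

lemma A_one: "\<one>\<^bsub>A\<^esub> = A_filt G H (Suc n)"
  by (simp add: A_gr_def)

lemma A_mult:
  assumes "u \<in> A_filt G H n" "v \<in> A_filt G H n"
  shows "A_cls u \<otimes>\<^bsub>A\<^esub> A_cls v = A_cls (u + v)"
proof -
  interpret ZG: comm_group ZG by (rule abelian_free_Abelian_group)
  have "set_mult (ZG\<lparr>carrier := A_filt G H n\<rparr>) = set_mult ZG"
    by (simp add: set_mult_def fun_eq_iff)
  moreover have "u \<in> carrier ZG" "v \<in> carrier ZG"
    using assms subgroup.mem_carrier[OF A_filt_subgroup] by blast+
  ultimately show ?thesis
    using normal.rcos_sum[OF ZG.subgroup_imp_normal[OF A_filt_subgroup[of "Suc n"]], of u v]
    by (simp add: A_gr_eq)
qed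

lemma A_comm_group: "comm_group A"
proof -
  interpret ZG: comm_group ZG by (rule abelian_free_Abelian_group)
  interpret An: comm_group "ZG\<lparr>carrier := A_filt G H n\<rparr>"
    by (rule ZG.subgroup_imp_comm_group[OF A_filt_subgroup])
  have "subgroup (A_filt G H (Suc n)) (ZG\<lparr>carrier := A_filt G H n\<rparr>)"
    by (intro ZG.subgroup_incl A_filt_subgroup A_filt_antimono) simp
  from An.abelian_FactGroup[OF this] show ?thesis
    by (simp add: A_gr_eq)
qed

text \<open>The definition of \<open>phi\<close> uses \<open>the_elem\<close>, so the class has to
  be constant on the coset. For \<open>h' = k \<otimes> h\<close> the difference is (k - 1)(h - 1) +
  (k - 1), and both terms lie in \<open>A_filt G H (Suc n)\<close>.\<close>

lemma phi_cls:
  assumes "h \<in> H n"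
  shows "phi G H n (cls h) = A_cls (gr_diff G h)"
proof -
  have h: "h \<in> carrier G" using assms H_carrier n_pos by blast
  have "A_cls (gr_diff G h') = A_cls (gr_diff G h)" if "h' \<in> cls h" for h'
  proof -
    obtain k where k: "k \<in> H (Suc n)" "h' = k \<otimes> h" using \<open>h' \<in> cls h\<close> by (auto simp: r_coset_def)
    then have kG: "k \<in> carrier G" using H_carrier[of "Suc n"] by auto
    \<comment> \<open>Here \<open>h\<close> counts with weight 1, as an element of the whole
      group.\<close>
    have "gr_diff G k \<bullet> gr_diff G h \<in> A_filt G H (Suc n)"
      using gr_diff_mult_in_A_filt[of "Suc n" k 1 h "Suc n"] k h by (simp add: H_one)
    moreover have "gr_diff G k \<in> A_filt G H (Suc n)" using gr_diff_in_A_filt[of "Suc n"] k by simp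
    ultimately have "gr_diff G h' - gr_diff G h \<in> A_filt G H (Suc n)"
      using A_filt_add by (simp add: k(2) gr_diff_of_mult kG h)
    then show ?thesis by (intro A_cls_eqI keys_gr_diff h)
  qed
  moreover have "h \<in> cls h" using rcos_self[OF h H_subgroup] by simp
  ultimately have "(\<lambda>h. A_cls (gr_diff G h)) ` cls h = {A_cls (gr_diff G h)}" by blast
  then show ?thesis by (simp only: phi_def add_monoid_group_ring the_elem_eq)
qed

lemma C_carrier_eq: "carrier C = cls ` H n"
  by (simp add: C_grp_eq kernel_p)

lemma phi_hom: "phi G H n \<in> hom C A"
proof (rule homI)
  show "phi G H n U \<in> carrier A" if "U \<in> carrier C" for U
    using that gr_diff_in_A_filt[OF n_pos] by (auto simp: C_carrier_eq A_carrier phi_cls)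
next
  fix U V assume "U \<in> carrier C" "V \<in> carrier C"
  then obtain x y where xy: "U = cls x" "x \<in> H n" "V = cls y" "y \<in> H n"
    by (auto simp: C_carrier_eq)
  then have G: "x \<in> carrier G" "y \<in> carrier G" using H_carrier n_pos by auto
  have m: "x \<otimes> y \<in> H n" using xy subgroup.m_closed[OF H_subgroup[OF n_pos]] by blast
  \<comment> \<open>The product has weight 2n, which is at least n + 1 because n is
    positive.\<close>
  have "gr_diff G x \<bullet> gr_diff G y \<in> A_filt G H (Suc n)"
    using gr_diff_mult_in_A_filt[OF n_pos xy(2) n_pos xy(4), of "Suc n"] n_pos by simp
  then have "A_cls (gr_diff G (x \<otimes> y)) = A_cls (gr_diff G x + gr_diff G y)"
    using G by (intro A_cls_eqI keys_add_subset keys_gr_diff) (simp_all add: gr_diff_of_mult)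
  moreover have "U \<otimes>\<^bsub>C\<^esub> V = cls (x \<otimes> y)" using xy G E_mult by (simp add: C_grp_eq)
  ultimately show "phi G H n (U \<otimes>\<^bsub>C\<^esub> V) = phi G H n U \<otimes>\<^bsub>A\<^esub> phi G H n V"
    using xy m gr_diff_in_A_filt[OF n_pos] by (simp add: phi_cls A_mult)
qed

lemma ker_phi_boundary:
  assumes "U \<in> carrier (ker_phi G H n)"
  shows "bar_symbol E [U] \<in> boundaries"
proof -
  interpret ZG: group ZG by simp
  obtain h where h: "U = cls h" "h \<in> H n" using assms by (auto simp: ker_phi_def kernel_def C_carrier_eq)
  then have hG: "h \<in> carrier G" using H_carrier n_pos by blast
  have "A_cls (gr_diff G h) = A_filt G H (Suc n)"
    using assms h by (simp add: ker_phi_def kernel_def phi_cls A_one)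
  then have "gr_diff G h \<in> A_filt G H (Suc n)"
    using ZG.coset_join1[OF _ _ A_filt_subgroup] keys_gr_diff[OF hG] by simp
  with symbol_boundary[OF hG] h show ?thesis by simp
qed

section \<open>The isomorphism induced by the transgression\<close>

lemma section_imp_central_extension:
  assumes "normalized_section G H n s"
  shows "central_extension E Q p s"
proof -
  interpret group_hom E Q p by (rule p_hom)
  show ?thesis
    by unfold_locales (use assms kernel_p_central in \<open>auto simp: normalized_section_def\<close>)
qed

lemma coker_R_bar_iso:
  assumes "normalized_section G H n s"
  shows "coker (L_bar G H n s) (D_bar G H n s) (R_bar G H n) \<cong> ker_phi G H n"
proof -
  interpret X: central_extension E Q p s
    by (rule section_imp_central_extension[OF assms])
  interpret A: comm_group A by (rule A_comm_group)
  have C: "X.C = C" by (simp add: C_grp_eq)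
  interpret phi: group_hom C A "phi G H n"
    using phi_hom X.C_comm_group
    by (simp add: group_hom_def group_hom_axioms_def C comm_group_def A.is_group)
  let ?\<tau> = X.transgression and ?Z = "bar_chains Q 2" and ?D = "D_bar G H n s" and ?K = "ker_phi G H n"
  let ?S = "bar_cells Q 2"
  interpret Z: comm_group ?Z unfolding bar_chains_eq by (rule abelian_free_Abelian_group)
  have cocycle: "alpha G H n s = X.cocycle"
    by (simp add: alpha_def X.cocycle_def fun_eq_iff)
  have \<tau>_hom: "?\<tau> \<in> hom ?Z C"
    using X.C.frag_prod_hom[OF X.cocycle_cells] by (simp add: X.transgression_def C bar_chains_eq)
  interpret \<tau>: group_hom ?Z C ?\<tau> using \<tau>_hom by unfold_locales
  have vartheta: "vartheta G H n s z = phi G H n (?\<tau> z)" if "Poly_Mapping.keys z \<subseteq> ?S" for z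
  proof -
    have "(\<lambda>qs. X.cocycle (qs ! 0) (qs ! 1)) ` ?S \<subseteq> carrier X.C" using X.cocycle_cells by simp
    from hom_frag_prod[OF X.C_comm_group A.comm_group_axioms _ this that, of "phi G H n"] phi_hom
    show ?thesis
      by (simp add: vartheta_def frag_prod_def X.transgression_def cocycle C del: One_nat_def)
  qed
  have D_eq: "?D = ?Z\<lparr>carrier := {z. Poly_Mapping.keys z \<subseteq> ?S \<and> bar_boundary Q z = 0
      \<and> phi G H n (?\<tau> z) = \<one>\<^bsub>A\<^esub>}\<rparr>"
    by (auto simp: D_bar_def bar_Z2_def bar_chains_eq kernel_def vartheta cong: conj_cong)
  \<comment> \<open>The explicit form of \<open>?D\<close> exhibits it as the cycles on which \<phi>
    \<circ> \<tau> vanishes; as a subgroup of the 2-chains it becomes a legitimate domain for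
    \<tau>.\<close>
  have D_sub: "subgroup (carrier ?D) ?Z"
  proof (rule Z.subgroupI)
    show "carrier ?D \<noteq> {}"
      using \<tau>.hom_one by (auto simp: D_eq bar_boundary_zero bar_chains_eq intro!: exI[of _ 0])
  next
    fix z assume "z \<in> carrier ?D"
    then show "inv\<^bsub>?Z\<^esub> z \<in> carrier ?D"
      using \<tau>.hom_inv[of z] \<tau>.hom_closed[of z] phi.hom_inv[of "?\<tau> z"]
      by (simp add: D_eq bar_boundary_minus bar_chains_eq)
  next
    fix z w assume "z \<in> carrier ?D" "w \<in> carrier ?D"
    then show "z \<otimes>\<^bsub>?Z\<^esub> w \<in> carrier ?D"
      using \<tau>.hom_mult[of z w] \<tau>.hom_closed[of z] \<tau>.hom_closed[of w] phi.hom_mult[of "?\<tau> z" "?\<tau> w"]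
      by (simp add: D_eq bar_boundary_add bar_chains_eq keys_add_subset)
  qed (auto simp: D_eq bar_chains_eq)
  have D_group: "group ?D" using Z.subgroup_imp_group[OF D_sub] by (simp add: D_eq)
  have K_group: "group ?K"
    unfolding ker_phi_def by (rule phi.G.subgroup_imp_group[OF phi.subgroup_kernel])
  have "?\<tau> \<in> hom ?D ?K"
    using \<tau>.hom_closed \<tau>.hom_mult by (auto intro!: homI simp: D_eq ker_phi_def kernel_def bar_chains_eq)
  then interpret T: group_hom ?D ?K ?\<tau>
    using D_group K_group by (simp add: group_hom_def group_hom_axioms_def)
  have surj: "?\<tau> ` carrier ?D = carrier ?K"
  proof
    show "?\<tau> ` carrier ?D \<subseteq> carrier ?K" using T.hom_closed by auto
    show "carrier ?K \<subseteq> ?\<tau> ` carrier ?D"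
    proof
      fix U assume U: "U \<in> carrier ?K"
      then have "U \<in> kernel E Q p" "phi G H n U = \<one>\<^bsub>A\<^esub>"
        unfolding ker_phi_def kernel_p C_carrier_eq[symmetric] by (simp_all add: kernel_def)
      \<comment> \<open>Since \<open>U\<close> lies in ker \<phi>, its symbol bounds a 2-chain
        \<open>w\<close> of \<open>E\<close>.\<close>
      moreover obtain w where "Poly_Mapping.keys w \<subseteq> bar_cells E 2" "bar_boundary E w = bar_symbol E [U]"
        using ker_phi_boundary[OF U] unfolding boundaries_def by auto
      ultimately show "U \<in> ?\<tau> ` carrier ?D"
        using X.transgression_surj[of U w]
        by (intro image_eqI[of _ _ "- bar_map Q p w"]) (auto simp: D_eq)
    qed
  qed
  \<comment> \<open>One inclusion holds because \<tau> kills both summands of \<open>R_bar\<close>;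
    the other is exactness.\<close>
  have "R_bar G H n ` carrier (L_bar G H n s) = kernel ?D ?K ?\<tau>"
  proof
    have one: "\<one>\<^bsub>?K\<^esub> = \<one>\<^bsub>E\<^esub>" by (simp add: ker_phi_def C_grp_eq)
    show "R_bar G H n ` carrier (L_bar G H n s) \<subseteq> kernel ?D ?K ?\<tau>"
    proof clarify
      fix z c assume L: "(z, c) \<in> carrier (L_bar G H n s)"
      then have z: "Poly_Mapping.keys z \<subseteq> bar_cells E 2" "bar_boundary E z = 0"
        and c: "Poly_Mapping.keys c \<subseteq> bar_cells Q 3"
        and D: "R_bar G H n (z, c) \<in> carrier ?D"
        by (auto simp: L_bar_def bar_Z2_def bar_chains_eq kernel_def)
      have "Poly_Mapping.keys (bar_map Q p z) \<subseteq> bar_cells Q 2"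
        using keys_bar_map[OF _ z(1), of p Q] by auto
      then have "?\<tau> (R_bar G H n (z, c)) = \<one>\<^bsub>E\<^esub>"
        using X.transgression_proj_cycle[OF z] X.transgression_boundary[OF c] X.H.keys_bar_boundary3[OF c]
        by (simp add: R_bar_def X.transgression_simps)
      with D show "R_bar G H n (z, c) \<in> kernel ?D ?K ?\<tau>" by (simp add: kernel_def one)
    qed
    show "kernel ?D ?K ?\<tau> \<subseteq> R_bar G H n ` carrier (L_bar G H n s)"
    proof
      fix z assume z: "z \<in> kernel ?D ?K ?\<tau>"
      then have D: "z \<in> carrier ?D" and "Poly_Mapping.keys z \<subseteq> ?S" "bar_boundary Q z = 0" "?\<tau> z = \<one>\<^bsub>E\<^esub>"
        by (auto simp: kernel_def one D_eq)
      then obtain z' where z': "Poly_Mapping.keys z' \<subseteq> bar_cells E 2" "bar_boundary E z' = 0" "bar_map Q p z' = z"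
        using X.transgression_exact by blast
      \<comment> \<open>The lift projects to \<open>z\<close> on the nose, so the 3-chain can be
        taken to be 0.\<close>
      then have "R_bar G H n (z', 0) = z" by (simp add: R_bar_def bar_boundary_zero)
      moreover from this have "(z', 0) \<in> carrier (L_bar G H n s)"
        using z' D by (simp add: L_bar_def bar_Z2_def bar_chains_eq kernel_def)
      ultimately show "z \<in> R_bar G H n ` carrier (L_bar G H n s)" by force
    qed
  qed
  \<comment> \<open>First isomorphism theorem for \<tau> from \<open>?D\<close> onto
    \<open>?K\<close>, whose kernel is the image of \<open>R_bar\<close>.\<close>
  then show ?thesis using T.FactGroup_iso[OF surj] by (simp add: coker_def)
qed

end

theorem theorem3p2:
  fixes G :: "('a, 'b) monoid_scheme" and H :: "nat \<Rightarrow> 'a set" and n :: nat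
    and s :: "'a set \<Rightarrow> 'a set"
  assumes "group G"
    and "N_series G H"
    and "1 \<le> n"
    and "normalized_section G H n s"
  shows "coker (L_bar G H n s) (D_bar G H n s) (R_bar G H n) \<cong> ker_phi G H n"
proof -
  interpret N_series_group G H n
    using assms by (simp add: N_series_group_def N_series_group_axioms_def)
  show ?thesis by (rule coker_R_bar_iso) fact
qed

end
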